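(* $E_{\mathbb Z_3',\{1\}}(3)=5$.
   Context: $\mathbb Z_3=\mathbb Z/3\mathbb Z$ as a module over itself and $\mathbb Z_3'=\mathbb Z_3\setminus\{0\}$. A subsequence is a non-empty subfamily of terms in the original order. For non-empty $A,B\subseteq\mathbb Z_n$, a sequence $(x_1,\ldots,x_k)$ is an $(A,B)$-weighted zero-sum sequence if there exist $a_i\in A$, $b_i\in B$ with $\sum a_ix_i=0$ and $\sum b_ia_i=0$. $E_{A,B}(n)$ is the least positive $k$ such that every sequence in $\mathbb Z_n$ of length $k$ has an $(A,B)$-weighted zero-sum subsequence of length $n$. *)

theory Defs
  imports "HOL-Library.Sublist" "HOL-Library.Extended_Nat" "HOL-Number_Theory.Cong"
begin

text \<open>Elements of \<open>\<int>/n\<int>\<close> (for \<open>n \<ge> 1\<close>) are represented by their least non-negative residues,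
  and equality in \<open>\<int>/n\<int>\<close> is congruence modulo \<open>n\<close>.\<close>

definition Zmod :: "nat \<Rightarrow> int set" where
  "Zmod n = {0..<int n}"

definition weighted_zero_sum :: "nat \<Rightarrow> int set \<Rightarrow> int set \<Rightarrow> int list \<Rightarrow> bool" where
  "weighted_zero_sum n A B xs \<longleftrightarrow>
     (\<exists>as bs. length as = length xs \<and> length bs = length xs \<and> set as \<subseteq> A \<and> set bs \<subseteq> B \<and>
        [(\<Sum>i<length xs. as ! i * xs ! i) = 0] (mod int n) \<and>
        [(\<Sum>i<length xs. bs ! i * as ! i) = 0] (mod int n))"

text \<open>The value is \<open>\<infinity>\<close> if no such \<open>k\<close> exists; a finite value is an attained minimum.\<close>

definition weighted_E :: "int set \<Rightarrow> int set \<Rightarrow> nat \<Rightarrow> enat" where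
  "weighted_E A B n =
     Inf (enat ` {k. k > 0 \<and>
       (\<forall>xs. set xs \<subseteq> Zmod n \<and> length xs = k \<longrightarrow>
         (\<exists>ys. ys \<noteq> [] \<and> subseq ys xs \<and> length ys = n \<and> weighted_zero_sum n A B ys))})"

end

theory Submission
  imports Defs
begin

text \<open>Three non-zero weights modulo 3 whose sum is zero are all equal, so being weighted zero-sum
  means being zero-sum in the usual sense and the constant is the Erdos--Ginzburg--Ziv constant of
  \<open>\<int>/3\<int>\<close>: among five residues either some value occurs three times or all three values occur,
  while \<open>0, 0, 1, 1\<close> has no zero-sum subsequence of length 3.\<close>

lemma Zmod_3: "Zmod 3 = {0, 1, 2}"
  by (auto simp: Zmod_def)

lemma Zmod_3_nonzero: "Zmod 3 - {0} = {1, 2}"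
  by (auto simp: Zmod_3)

lemma weighted_zero_sum_3_iff:
  "weighted_zero_sum 3 (Zmod 3 - {0}) {1} [x, y, z] \<longleftrightarrow> 3 dvd x + y + z"
proof
  assume "weighted_zero_sum 3 (Zmod 3 - {0}) {1} [x, y, z]"
  then obtain as bs where len: "length as = length [x, y, z]" "length bs = length [x, y, z]"
    and sets: "set as \<subseteq> {1, 2}" "set bs \<subseteq> {1}"
    and sums: "[(\<Sum>i<length [x, y, z]. as ! i * [x, y, z] ! i) = 0] (mod int 3)"
      "[(\<Sum>i<length [x, y, z]. bs ! i * as ! i) = 0] (mod int 3)"
    unfolding weighted_zero_sum_def Zmod_3_nonzero by blast
  from len obtain a b c d e f where "as = [a, b, c]" "bs = [d, e, f]"
    by (auto simp: length_Suc_conv)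
  then have ab: "a \<in> {1, 2}" "b \<in> {1, 2}" "c \<in> {1, 2}" "3 dvd a + b + c"
    and "3 dvd a * x + b * y + c * z"
    using sets sums by (auto simp: cong_0_iff ac_simps)
  \<comment> \<open>The sum of the weights lies between 3 and 6, and 3 divides it only at the two
    ends, where all weights are 1 or all are 2.\<close>
  moreover from ab have "a = b \<and> b = c"
    by auto
  ultimately have "3 dvd a * (x + y + z)" "a \<in> {1, 2}"
    by (auto simp: algebra_simps)
  \<comment> \<open>Both 1 and 2 are units modulo 3, so the common weight \<open>a\<close>
    cancels.\<close>
  then show "3 dvd x + y + z"
    by (elim insertE emptyE; hypsubst) presburger+
next
  assume "3 dvd x + y + z"
  then show "weighted_zero_sum 3 (Zmod 3 - {0}) {1} [x, y, z]"
    unfolding weighted_zero_sum_def Zmod_3_nonzero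
    \<comment> \<open>The same list of ones serves for \<open>as\<close> and for \<open>bs\<close>;
      the second sum is then 3.\<close>
    by (intro exI[of _ "[1, 1, 1]"]) (simp add: cong_0_iff ac_simps)
qed

lemma length_5_has_zero_sum_subseq_3:
  assumes "set xs \<subseteq> Zmod 3" "length xs = 5"
  shows "\<exists>x y z. subseq [x, y, z] xs \<and> 3 dvd x + y + z"
proof -
  obtain a b c d e where xs: "xs = [a, b, c, d, e]"
    using assms(2) by (auto simp: eval_nat_numeral length_Suc_conv)
  have "a \<in> {0, 1, 2}" "b \<in> {0, 1, 2}" "c \<in> {0, 1, 2}" "d \<in> {0, 1, 2}" "e \<in> {0, 1, 2}"
    using assms(1) by (auto simp: xs Zmod_3)
  \<comment> \<open>The disjuncts run over all ten ways to choose three of the five positions; the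
    3^5 assignments of residues are checked one by one.\<close>
  then have "3 dvd a + b + c \<or> 3 dvd a + b + d \<or> 3 dvd a + b + e \<or> 3 dvd a + c + d \<or>
      3 dvd a + c + e \<or> 3 dvd a + d + e \<or> 3 dvd b + c + d \<or> 3 dvd b + c + e \<or>
      3 dvd b + d + e \<or> 3 dvd c + d + e"
    by (elim insertE emptyE; hypsubst; simp)
  moreover have "subseq [a, b, c] xs" "subseq [a, b, d] xs" "subseq [a, b, e] xs"
    "subseq [a, c, d] xs" "subseq [a, c, e] xs" "subseq [a, d, e] xs" "subseq [b, c, d] xs"
    "subseq [b, c, e] xs" "subseq [b, d, e] xs" "subseq [c, d, e] xs"
    by (auto simp: xs)
  ultimately show ?thesis
    by blast
qed

text \<open>Three of these four terms are 0, 0, 1 or 0, 1, 1, with sum 1 or 2.\<close>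

lemma no_zero_sum_subseq_0011:
  assumes "subseq [x, y, z] [0, 0, 1, 1 :: int]"
  shows "\<not> 3 dvd x + y + z"
  using assms by (auto split: if_splits)

theorem theorem8: "weighted_E (Zmod 3 - {0}) {1} 3 = 5"
  unfolding weighted_E_def
\<comment> \<open>The upper bound amounts to 5 being in the set, the lower bound to every member of
  the set being at least 5.\<close>
proof (intro antisym Inf_lower Inf_greatest)
  have "\<exists>ys. ys \<noteq> [] \<and> subseq ys xs \<and> length ys = 3 \<and>
      weighted_zero_sum 3 (Zmod 3 - {0}) {1} ys"
    if xs: "set xs \<subseteq> Zmod 3" "length xs = 5" for xs
  proof -
    obtain x y z where "subseq [x, y, z] xs" "3 dvd x + y + z"
      using length_5_has_zero_sum_subseq_3[OF xs] by blast
    then show ?thesis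
      by (intro exI[of _ "[x, y, z]"]) (simp add: weighted_zero_sum_3_iff)
  qed
  then show "5 \<in> enat ` {k. k > 0 \<and> (\<forall>xs. set xs \<subseteq> Zmod 3 \<and> length xs = k \<longrightarrow>
      (\<exists>ys. ys \<noteq> [] \<and> subseq ys xs \<and> length ys = 3 \<and>
        weighted_zero_sum 3 (Zmod 3 - {0}) {1} ys))}"
    by (intro image_eqI[of _ _ 5]) (simp_all add: numeral_eq_enat)
next
  fix m
  assume "m \<in> enat ` {k. k > 0 \<and> (\<forall>xs. set xs \<subseteq> Zmod 3 \<and> length xs = k \<longrightarrow>
      (\<exists>ys. ys \<noteq> [] \<and> subseq ys xs \<and> length ys = 3 \<and>
        weighted_zero_sum 3 (Zmod 3 - {0}) {1} ys))}"
  then obtain k where m: "m = enat k"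
    and k: "\<And>xs. set xs \<subseteq> Zmod 3 \<Longrightarrow> length xs = k \<Longrightarrow>
      \<exists>ys. subseq ys xs \<and> length ys = 3 \<and> weighted_zero_sum 3 (Zmod 3 - {0}) {1} ys"
    by blast
  have "k \<ge> 5"
  proof (rule ccontr)
    assume "\<not> k \<ge> 5"
    \<comment> \<open>Lengths below 4 need a counterexample too. A prefix of
      \<open>[0, 0, 1, 1]\<close> serves for each \<open>k \<le> 4\<close>, since its subsequences
      are also subsequences of the whole list.\<close>
    define xs :: "int list" where "xs = take k [0, 0, 1, 1]"
    have "set xs \<subseteq> Zmod 3"
      using set_take_subset[of k "[0, 0, 1, 1 :: int]"] by (auto simp: xs_def Zmod_3)
    moreover have "length xs = k"
      using \<open>\<not> k \<ge> 5\<close> by (simp add: xs_def)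
    ultimately obtain ys where ys: "subseq ys xs" "length ys = 3"
        "weighted_zero_sum 3 (Zmod 3 - {0}) {1} ys"
      using k by blast
    then obtain x y z where xyz: "ys = [x, y, z]"
      by (auto simp: numeral_3_eq_3 length_Suc_conv)
    have "subseq xs [0, 0, 1, 1]"
      unfolding xs_def by (intro prefix_imp_subseq take_is_prefix)
    with ys(1) have "subseq [x, y, z] [0, 0, 1, 1]"
      unfolding xyz by (rule subseq_order.trans)
    then show False
      using no_zero_sum_subseq_0011 ys(3) by (simp add: xyz weighted_zero_sum_3_iff)
  qed
  then show "5 \<le> m"
    by (simp add: m numeral_eq_enat)
qed

end
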